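(* Let $0\le a<b$ be real numbers, let $\alpha>0$, let $s\in(0,1]$, let $q\ge 1$, and let $r$ satisfy $a<r\le b$. Let $f:[a,b]\to\mathbb{R}$ be differentiable on $(a,b)$, with one-sided derivatives $f'(a)$ and $f'(b)$ existing at the endpoints, and suppose $f'\in L_1[a,b]$. If $|f'|^q$ is $s$-convex in the second sense on $[a,b]$, then $$\left|\frac{f(a)+f(r)}{2}-\frac{\Gamma(\alpha+1)}{2(r-a)^{\alpha}}\left[J_{a^+}^{\alpha}f(r)+J_{r^-}^{\alpha}f(a)\right]\right|\le \frac{r-a}{2}\left[\frac{2}{\alpha+1}\left(1-\frac{1}{2^{\alpha}}\right)\right]^{1-\frac1q}\left[\beta\left(\tfrac12;s+1,\alpha+1\right)-\beta\left(\tfrac12;\alpha+1,s+1\right)+\frac{2^{\alpha+s}-1}{(\alpha+s+1)2^{\alpha+s}}\right]^{\frac1q}\left(|f'(a)|^q+|f'(r)|^q\right)^{\frac1q}.$$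
   Context: A function $g:[a,b]\to\mathbb{R}$ with $[a,b]\subset[0,\infty)$ is $s$-convex in the second sense on $[a,b]$, for a fixed $s\in(0,1]$, if $g(tx+(1-t)y)\le t^s g(x)+(1-t)^s g(y)$ for all $x,y\in[a,b]$ and $t\in[0,1]$. For $\alpha>0$ the Riemann-Liouville fractional integrals are $J_{a^+}^{\alpha}f(x)=\frac{1}{\Gamma(\alpha)}\int_a^x (x-t)^{\alpha-1}f(t)\,dt$ for $x>a$, and $J_{r^-}^{\alpha}f(x)=\frac{1}{\Gamma(\alpha)}\int_x^r (t-x)^{\alpha-1}f(t)\,dt$ for $x<r$, where $\Gamma$ is the Gamma function. $\beta(x;p,q)=\int_0^x u^{p-1}(1-u)^{q-1}\,du$ denotes the incomplete beta function. *)

theory Defs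
  imports "HOL-Analysis.Analysis"
begin

definition s_convex_on :: "real \<Rightarrow> real set \<Rightarrow> (real \<Rightarrow> real) \<Rightarrow> bool" where
  "s_convex_on s S g \<longleftrightarrow>
     (\<forall>x\<in>S. \<forall>y\<in>S. \<forall>t\<in>{0..1}.
        g (t * x + (1 - t) * y) \<le> t powr s * g x + (1 - t) powr s * g y)"

(* Lebesgue integrals: for alpha < 1 the kernel is singular at one endpoint.
   The conventional value 0 powr (alpha - 1) = 0 there affects only a null set. *)

definition RL_left :: "real \<Rightarrow> real \<Rightarrow> (real \<Rightarrow> real) \<Rightarrow> real \<Rightarrow> real" where
  "RL_left \<alpha> a f x =
     1 / Gamma \<alpha> * (LINT t:{a..x}|lebesgue. (x - t) powr (\<alpha> - 1) * f t)"

definition RL_right :: "real \<Rightarrow> real \<Rightarrow> (real \<Rightarrow> real) \<Rightarrow> real \<Rightarrow> real" where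
  "RL_right \<alpha> r f x =
     1 / Gamma \<alpha> * (LINT t:{x..r}|lebesgue. (t - x) powr (\<alpha> - 1) * f t)"

definition incomplete_beta :: "real \<Rightarrow> real \<Rightarrow> real \<Rightarrow> real" where
  "incomplete_beta x p q =
     (LINT u:{0..x}|lebesgue. u powr (p - 1) * (1 - u) powr (q - 1))"

end

theory Submission
  imports Defs
begin

text \<open>
  Put \<open>L = r - a\<close> and \<open>k x = (x - a) powr \<alpha> - (r - x) powr \<alpha>\<close>. The derivative of \<open>k\<close> is \<open>\<alpha>\<close> times
  the sum of the two Riemann-Liouville kernels, so integrating \<open>(k f)'\<close> over \<open>[a, r]\<close> turns the
  trapezoid error into \<open>1 / (2 L powr \<alpha>)\<close> times the integral of \<open>k f'\<close>
  (\<open>fractional_trapezoid_identity\<close>).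

  It remains to bound the integral of \<open>\<bar>k\<bar> \<bar>f'\<bar>\<close>. The power-mean inequality with weight \<open>\<bar>k\<bar>\<close>
  (\<open>weighted_power_mean\<close>) separates it into the total mass of \<open>\<bar>k\<bar>\<close> and the integral of
  \<open>\<bar>k\<bar> \<bar>f'\<bar> powr q\<close>. In the coordinate \<open>t = (r - x) / L\<close>, where \<open>x = t a + (1 - t) r\<close>, the
  \<open>s\<close>-convexity of \<open>\<bar>f'\<bar> powr q\<close> dominates \<open>\<bar>f'\<bar> powr q\<close> by
  \<open>t powr s \<bar>f' a\<bar> powr q + (1 - t) powr s \<bar>f' r\<bar> powr q\<close>, and \<open>\<bar>k\<bar>\<close> becomes \<open>L powr \<alpha>\<close> times the
  weight \<open>\<bar>(1 - t) powr \<alpha> - t powr \<alpha>\<bar>\<close> on \<open>[0, 1]\<close>. That weight is symmetric about \<open>1/2\<close>, so both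
  terms have the same coefficient, the \<open>s\<close>-th moment of the weight. Its mass and its moment
  (\<open>has_integral_abs_powr_diff\<close> and \<open>has_integral_abs_powr_diff_times_powr\<close>) are the two bracketed
  constants of the estimate.
\<close>

section \<open>The weight \<open>\<bar>(1 - t) powr \<alpha> - t powr \<alpha>\<bar>\<close> on the unit interval\<close>

text \<open>
  Besides moving integrals from \<open>[0, 1]\<close> to \<open>[a, r]\<close>, this gives the reflection \<open>t \<mapsto> 1 - t\<close> as the
  case \<open>p = L = 1\<close>.
\<close>
lemma has_integral_reflect_scale:
  fixes g :: "real \<Rightarrow> real"
  assumes g: "(g has_integral I) {c..d}" and L: "0 < L"
  shows "((\<lambda>x. g ((p - x) / L)) has_integral L * I) {p - L * d..p - L * c}"
proof (cases "c \<le> d")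
  case True
  have "((\<lambda>x. g ((- 1 / L) *\<^sub>R x + p / L)) has_integral (1 / \<bar>- 1 / L\<bar> ^ DIM(real)) *\<^sub>R I)
          ((\<lambda>x. (1 / (- 1 / L)) *\<^sub>R x + - ((1 / (- 1 / L)) *\<^sub>R (p / L))) ` cbox c d)"
    by (rule has_integral_affinity) (use g L in auto)
  moreover have "(\<lambda>x. (1 / (- 1 / L)) *\<^sub>R x + - ((1 / (- 1 / L)) *\<^sub>R (p / L))) ` cbox c d
      = (\<lambda>x. (- L) * x + p) ` {c..d}"
    using L by (intro image_cong) auto
  moreover have "\<dots> = {p - L * d..p - L * c}"
    using L True by (subst image_affinity_atLeastAtMost) (auto simp: algebra_simps)
  moreover have "(\<lambda>x. g ((- 1 / L) *\<^sub>R x + p / L)) = (\<lambda>x. g ((p - x) / L))"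
    by (simp add: diff_divide_distrib)
  ultimately show ?thesis
    using L by simp
next
  case False
  with g have "I = 0" "p - L * d > p - L * c"
    using L by (auto dest: has_integral_unique[OF has_integral_empty])
  then show ?thesis by auto
qed

text \<open>
  On \<open>[0, 1/2]\<close> the absolute value opens with a positive sign and there is an elementary
  antiderivative; the other half contributes the same by symmetry.
\<close>
lemma has_integral_abs_powr_diff:
  fixes \<alpha> :: real
  assumes "0 < \<alpha>"
  shows "((\<lambda>t. \<bar>(1 - t) powr \<alpha> - t powr \<alpha>\<bar>) has_integral
           2 / (\<alpha> + 1) * (1 - 1 / 2 powr \<alpha>)) {0..1}"
proof -
  define A where "A = (1 - 1 / 2 powr \<alpha>) / (\<alpha> + 1)"
  define F where "F = (\<lambda>t::real. - ((1 - t) powr (\<alpha> + 1) + t powr (\<alpha> + 1)) / (\<alpha> + 1))"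
  have "((\<lambda>t. (1 - t) powr \<alpha> - t powr \<alpha>) has_integral (F (1/2) - F 0)) {0..1/2}"
  proof (rule fundamental_theorem_of_calculus_interior)
    show "continuous_on {0..1/2} F"
      unfolding F_def using assms by (intro continuous_intros continuous_on_powr') auto
    fix t :: real
    assume t: "t \<in> {0<..<1/2}"
    have "((\<lambda>t. - ((1 - t) powr (\<alpha> + 1) + t powr (\<alpha> + 1))) has_real_derivative
        - ((\<alpha> + 1) * t powr \<alpha> - (\<alpha> + 1) * (1 - t) powr \<alpha>)) (at t)"
      using t by (auto intro!: derivative_eq_intros simp: algebra_simps)
    then have "(F has_real_derivative
        - ((\<alpha> + 1) * t powr \<alpha> - (\<alpha> + 1) * (1 - t) powr \<alpha>) / (\<alpha> + 1)) (at t)"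
      unfolding F_def by (rule DERIV_cdivide)
    also have "- ((\<alpha> + 1) * t powr \<alpha> - (\<alpha> + 1) * (1 - t) powr \<alpha>) / (\<alpha> + 1)
        = (1 - t) powr \<alpha> - t powr \<alpha>"
      using assms by (simp add: right_diff_distrib[symmetric])
    finally show "(F has_vector_derivative (1 - t) powr \<alpha> - t powr \<alpha>) (at t)"
      unfolding has_real_derivative_iff_has_vector_derivative .
  qed auto
  moreover have "F (1/2) - F 0 = A"
    by (simp add: F_def A_def powr_add powr_divide diff_divide_distrib)
  moreover have "\<bar>(1 - t) powr \<alpha> - t powr \<alpha>\<bar> = (1 - t) powr \<alpha> - t powr \<alpha>"
    if "t \<in> {0..1/2}" for t :: real
    using powr_mono2[of \<alpha> t "1 - t"] that assms by auto
  ultimately have left: "((\<lambda>t. \<bar>(1 - t) powr \<alpha> - t powr \<alpha>\<bar>) has_integral A) {0..1/2}"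
    by (metis (no_types, lifting) has_integral_eq)
  from has_integral_reflect_scale[OF left, of 1 1]
  have right: "((\<lambda>t. \<bar>(1 - t) powr \<alpha> - t powr \<alpha>\<bar>) has_integral A) {1/2..1}"
    by (simp add: abs_minus_commute)
  from has_integral_combine[OF _ _ left right] show ?thesis
    by (simp add: A_def)
qed

lemma has_integral_incomplete_beta:
  assumes "0 \<le> x" "x < 1" "1 < p"
  shows "((\<lambda>u. u powr (p - 1) * (1 - u) powr (q - 1)) has_integral incomplete_beta x p q) {0..x}"
proof -
  have "(\<lambda>u. u powr (p - 1) * (1 - u) powr (q - 1)) absolutely_integrable_on {0..x}"
    using assms
    by (intro absolutely_integrable_continuous_real continuous_intros continuous_on_powr') auto
  from has_integral_set_lebesgue[OF this] show ?thesis
    by (simp add: incomplete_beta_def)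
qed

text \<open>
  On each half of the interval the absolute value opens, and the integrand is the difference of
  \<open>t powr (\<alpha> + s)\<close> and the beta integrand \<open>t powr s * (1 - t) powr \<alpha>\<close>, with opposite signs on the
  two halves. The reflection \<open>t \<mapsto> 1 - t\<close> exchanges the exponents of the beta integrand and thereby
  turns its integral over \<open>[1/2, 1]\<close> into the second incomplete beta value.
\<close>
lemma has_integral_abs_powr_diff_times_powr:
  fixes \<alpha> s :: real
  assumes \<alpha>: "0 < \<alpha>" and s: "0 < s"
  shows "((\<lambda>t. \<bar>(1 - t) powr \<alpha> - t powr \<alpha>\<bar> * t powr s) has_integral
           incomplete_beta (1 / 2) (s + 1) (\<alpha> + 1) - incomplete_beta (1 / 2) (\<alpha> + 1) (s + 1)
           + (2 powr (\<alpha> + s) - 1) / ((\<alpha> + s + 1) * 2 powr (\<alpha> + s))) {0..1}"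
proof -
  define m where "m = \<alpha> + s"
  define h where "h = (1 / 2 :: real) powr (m + 1) / (m + 1)"
  have m: "0 < m" using assms by (simp add: m_def)
  have b1: "((\<lambda>t. t powr s * (1 - t) powr \<alpha>) has_integral incomplete_beta (1/2) (s + 1) (\<alpha> + 1)) {0..1/2}"
    using has_integral_incomplete_beta[of "1/2" "s + 1" "\<alpha> + 1"] s by simp
  have p1: "((\<lambda>t. t powr m) has_integral h) {0..1/2}"
    using has_integral_powr_from_0[of m "1/2"] m by (simp add: h_def)
  have "((\<lambda>t. t powr s * (1 - t) powr \<alpha> - t powr m) has_integral
      incomplete_beta (1/2) (s + 1) (\<alpha> + 1) - h) {0..1/2}"
    by (rule has_integral_diff[OF b1 p1])
  moreover have "t powr s * (1 - t) powr \<alpha> - t powr m = \<bar>(1 - t) powr \<alpha> - t powr \<alpha>\<bar> * t powr s"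
    if "t \<in> {0..1/2}" for t :: real
    using powr_mono2[of \<alpha> t "1 - t"] that assms by (auto simp: m_def powr_add algebra_simps)
  ultimately have left: "((\<lambda>t. \<bar>(1 - t) powr \<alpha> - t powr \<alpha>\<bar> * t powr s) has_integral
      incomplete_beta (1/2) (s + 1) (\<alpha> + 1) - h) {0..1/2}"
    by (metis (no_types, lifting) has_integral_eq)
  have "((\<lambda>t. t powr \<alpha> * (1 - t) powr s) has_integral incomplete_beta (1/2) (\<alpha> + 1) (s + 1)) {0..1/2}"
    using has_integral_incomplete_beta[of "1/2" "\<alpha> + 1" "s + 1"] \<alpha> by simp
  from has_integral_reflect_scale[OF this, of 1 1]
  have b2: "((\<lambda>t. (1 - t) powr \<alpha> * t powr s) has_integral incomplete_beta (1/2) (\<alpha> + 1) (s + 1)) {1/2..1}"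
    by simp
  have p2: "((\<lambda>t. t powr m) has_integral 1 / (m + 1) - h) {1/2..1}"
  proof -
    have full: "((\<lambda>t. t powr m) has_integral 1 / (m + 1)) {0..1}"
      using has_integral_powr_from_0[of m 1] m by simp
    then have "(\<lambda>t. t powr m) integrable_on {1/2..1}"
      by (intro integrable_on_subinterval[OF has_integral_integrable[OF full]]) auto
    then obtain j where j: "((\<lambda>t. t powr m) has_integral j) {1/2..1}"
      by (auto simp: integrable_on_def)
    have "((\<lambda>t. t powr m) has_integral h + j) {0..1}"
      by (rule has_integral_combine[OF _ _ p1 j]) auto
    from has_integral_unique[OF this full] have "j = 1 / (m + 1) - h" by linarith
    with j show ?thesis by simp
  qed
  have "((\<lambda>t. t powr m - (1 - t) powr \<alpha> * t powr s) has_integral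
      1 / (m + 1) - h - incomplete_beta (1/2) (\<alpha> + 1) (s + 1)) {1/2..1}"
    by (rule has_integral_diff[OF p2 b2])
  moreover have "t powr m - (1 - t) powr \<alpha> * t powr s = \<bar>(1 - t) powr \<alpha> - t powr \<alpha>\<bar> * t powr s"
    if "t \<in> {1/2..1}" for t :: real
    using powr_mono2[of \<alpha> "1 - t" t] that assms by (auto simp: m_def powr_add algebra_simps)
  ultimately have right: "((\<lambda>t. \<bar>(1 - t) powr \<alpha> - t powr \<alpha>\<bar> * t powr s) has_integral
      1 / (m + 1) - h - incomplete_beta (1/2) (\<alpha> + 1) (s + 1)) {1/2..1}"
    by (metis (no_types, lifting) has_integral_eq)
  have "1 / (m + 1) - 2 * h = (2 powr m - 1) / ((m + 1) * 2 powr m)"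
  proof -
    have "2 * h = 1 / ((m + 1) * 2 powr m)"
      by (simp add: h_def powr_add powr_divide)
    then show ?thesis
      using m by (simp add: diff_divide_distrib)
  qed
  with has_integral_combine[OF _ _ left right] show ?thesis
    by (simp add: m_def algebra_simps)
qed

section \<open>The weighted power-mean inequality\<close>

text \<open>
  The concave function \<open>u \<mapsto> u powr (1 / q)\<close> lies below its tangent at \<open>u = c powr q\<close>; the inequality
  is this at \<open>u = y powr q\<close>.
\<close>
lemma powr_tangent_bound:
  fixes y c q :: real
  assumes "0 \<le> y" "0 < c" "1 \<le> q"
  shows "y \<le> c powr (1 - q) * y powr q / q + (1 - 1 / q) * c"
proof (cases "y = 0")
  case False
  with assms have y: "0 < y" by simp
  have "(c powr (1 - q) * y powr q) powr (1 / q) * c powr (1 - 1 / q)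
      \<le> 1 / q * (c powr (1 - q) * y powr q) + (1 - 1 / q) * c"
    by (rule Youngs_inequality_0) (use assms y in auto)
  moreover have "(c powr (1 - q) * y powr q) powr (1 / q) * c powr (1 - 1 / q) = y"
  proof -
    have "(1 - q) / q + (1 - 1 / q) = 0" using assms by (simp add: field_simps)
    then have "c powr ((1 - q) / q) * c powr (1 - 1 / q) = 1"
      using assms by (simp add: powr_add[symmetric])
    then show ?thesis
      using assms y by (simp add: powr_mult powr_powr)
  qed
  ultimately show ?thesis by simp
qed (use assms in auto)

text \<open>
  The tangent bound makes the integral linear in \<open>h powr q\<close>, with a free parameter \<open>c\<close> over which one
  then optimises. The majorant \<open>H\<close> of \<open>h powr q\<close> stands for what a convexity hypothesis supplies.
\<close>
lemma weighted_power_mean: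
  fixes w h H :: "real \<Rightarrow> real"
  assumes q: "1 \<le> q"
    and w: "(w has_integral A) S" "\<And>x. x \<in> S \<Longrightarrow> 0 \<le> w x" "0 < A"
    and wh: "((\<lambda>x. w x * h x) has_integral I) S" "\<And>x. x \<in> S \<Longrightarrow> 0 \<le> h x"
    and wH: "((\<lambda>x. w x * H x) has_integral B) S" "\<And>x. x \<in> S \<Longrightarrow> h x powr q \<le> H x"
  shows "I \<le> A powr (1 - 1 / q) * B powr (1 / q)"
proof -
  have bound: "I \<le> c powr (1 - q) / q * B + (1 - 1 / q) * c * A" if c: "0 < c" for c
  proof (rule has_integral_le[OF wh(1)])
    show "((\<lambda>x. c powr (1 - q) / q * (w x * H x) + (1 - 1 / q) * c * w x) has_integral
        c powr (1 - q) / q * B + (1 - 1 / q) * c * A) S"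
      by (intro has_integral_add has_integral_mult_right wH w)
    fix x assume x: "x \<in> S"
    have "h x \<le> c powr (1 - q) * h x powr q / q + (1 - 1 / q) * c"
      using powr_tangent_bound[of "h x" c q] wh(2)[OF x] c q by simp
    also have "\<dots> \<le> c powr (1 - q) * H x / q + (1 - 1 / q) * c"
      using wH(2)[OF x] q by (simp add: divide_right_mono mult_left_mono)
    finally have "w x * h x \<le> w x * (c powr (1 - q) * H x / q + (1 - 1 / q) * c)"
      using w(2)[OF x] by (rule mult_left_mono)
    then show "w x * h x \<le> c powr (1 - q) / q * (w x * H x) + (1 - 1 / q) * c * w x"
      by (simp add: algebra_simps)
  qed
  have "0 \<le> H x" if "x \<in> S" for x
    using wH(2)[OF that] powr_ge_zero[of "h x" q] by linarith
  then have "0 \<le> B"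
    using w(2) by (intro has_integral_nonneg[OF wH(1)]) auto
  then consider "B = 0" | "0 < B" by linarith
  then show ?thesis
  proof cases
    case 1
    \<comment> \<open>Here the optimal parameter degenerates to 0, so the bound is used with a small positive one.\<close>
    have "\<not> 0 < I"
    proof
      assume I: "0 < I"
      then have "I \<le> (1 - 1 / q) * (I / (2 * A)) * A"
        using bound[of "I / (2 * A)"] 1 w(3) by simp
      also have "\<dots> \<le> I / 2"
        using I w(3) q by (simp add: field_simps)
      finally show False using I by simp
    qed
    with 1 show ?thesis by simp
  next
    case 2
    \<comment> \<open>The \<open>q\<close>-th power mean of a function with \<open>q\<close>-th power \<open>H\<close>, which minimises the bound.\<close>
    define c where "c = (B / A) powr (1 / q)"
    have c: "0 < c" using 2 w(3) by (simp add: c_def)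
    have "c powr q = B / A" using 2 w(3) q by (simp add: c_def powr_powr)
    then have "c powr (1 - q) * B = c * A"
      using c 2 w(3) by (simp add: powr_diff)
    then have "c powr (1 - q) / q * B + (1 - 1 / q) * c * A = c * A"
      using q by (simp add: field_simps)
    also have "c * A = A powr (1 - 1 / q) * B powr (1 / q)"
      using w(3) by (simp add: c_def powr_divide powr_diff field_simps)
    finally show ?thesis using bound[OF c] by simp
  qed
qed

section \<open>The trapezoid error as an integral of the derivative\<close>

lemma continuous_times_absolutely_integrable:
  fixes f g :: "real \<Rightarrow> real"
  assumes "continuous_on {a..b} f" "g absolutely_integrable_on {a..b}"
  shows "(\<lambda>x. f x * g x) absolutely_integrable_on {a..b}"
proof (rule absolutely_integrable_bounded_measurable_product_real)
  show "f \<in> borel_measurable (lebesgue_on {a..b})"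
    using assms by (intro continuous_imp_measurable_on_sets_lebesgue) auto
  show "bounded (f ` {a..b})"
    using assms by (intro compact_imp_bounded compact_continuous_image) auto
qed (use assms in auto)

text \<open>
  The fundamental theorem of calculus applied to \<open>k f\<close>, where \<open>k\<close> takes the values
  \<open>- (b - a) powr \<alpha>\<close> and \<open>(b - a) powr \<alpha>\<close> at the endpoints. For \<open>\<alpha> < 1\<close> the derivative of \<open>k\<close> blows up
  there, so the version requiring differentiability only in the interior is used; absolute
  integrability of the three summands of \<open>(k f)'\<close> allows their integrals to be separated and
  identified with the Lebesgue integrals in \<open>RL_left\<close> and \<open>RL_right\<close>.
\<close>
lemma fractional_trapezoid_identity:
  fixes f f' :: "real \<Rightarrow> real"
  assumes ab: "a < b" and \<alpha>: "0 < \<alpha>"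
    and f: "continuous_on {a..b} f"
    and f': "\<And>x. x \<in> {a<..<b} \<Longrightarrow> (f has_real_derivative f' x) (at x)"
    and int: "f' absolutely_integrable_on {a..b}"
  shows "(f a + f b) / 2
           - Gamma (\<alpha> + 1) / (2 * (b - a) powr \<alpha>) * (RL_left \<alpha> a f b + RL_right \<alpha> b f a)
         = integral {a..b} (\<lambda>x. ((x - a) powr \<alpha> - (b - x) powr \<alpha>) * f' x) / (2 * (b - a) powr \<alpha>)"
proof -
  define k where "k = (\<lambda>x. (x - a) powr \<alpha> - (b - x) powr \<alpha>)"
  define I where "I = integral {a..b} (\<lambda>x. k x * f' x)"
  have contk: "continuous_on {a..b} k"
    unfolding k_def using \<alpha> by (intro continuous_intros continuous_on_powr') auto
  have kf': "((\<lambda>x. k x * f' x) has_integral I) {a..b}"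
    unfolding I_def
    by (intro integrable_integral set_lebesgue_integral_eq_integral(1)
          continuous_times_absolutely_integrable contk int)
  have kernel_right: "((\<lambda>x. (b - x) powr (\<alpha> - 1)) has_integral (b - a) powr \<alpha> / \<alpha>) {a..b}"
    using has_integral_reflect_scale[OF has_integral_powr_from_0[of "\<alpha> - 1" "b - a"], of 1 b] ab \<alpha>
    by simp
  have kernel_left: "((\<lambda>x. (x - a) powr (\<alpha> - 1)) has_integral (b - a) powr \<alpha> / \<alpha>) {a..b}"
    using has_integral_reflect_scale[OF kernel_right, of 1 "a + b"] by simp
  have "(\<lambda>x. (b - x) powr (\<alpha> - 1)) absolutely_integrable_on {a..b}"
    using kernel_right by (intro nonnegative_absolutely_integrable_1) auto
  from continuous_times_absolutely_integrable[OF f this]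
  have "(\<lambda>x. (b - x) powr (\<alpha> - 1) * f x) absolutely_integrable_on {a..b}"
    by (simp add: mult.commute)
  from has_integral_set_lebesgue[OF this]
  have left: "((\<lambda>x. (b - x) powr (\<alpha> - 1) * f x) has_integral Gamma \<alpha> * RL_left \<alpha> a f b) {a..b}"
    using Gamma_real_pos[OF \<alpha>] by (simp add: RL_left_def)
  have "(\<lambda>x. (x - a) powr (\<alpha> - 1)) absolutely_integrable_on {a..b}"
    using kernel_left by (intro nonnegative_absolutely_integrable_1) auto
  from continuous_times_absolutely_integrable[OF f this]
  have "(\<lambda>x. (x - a) powr (\<alpha> - 1) * f x) absolutely_integrable_on {a..b}"
    by (simp add: mult.commute)
  from has_integral_set_lebesgue[OF this]
  have right: "((\<lambda>x. (x - a) powr (\<alpha> - 1) * f x) has_integral Gamma \<alpha> * RL_right \<alpha> b f a) {a..b}"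
    using Gamma_real_pos[OF \<alpha>] by (simp add: RL_right_def)
  have "((\<lambda>x. k x * f' x + \<alpha> * ((b - x) powr (\<alpha> - 1) * f x + (x - a) powr (\<alpha> - 1) * f x))
      has_integral k b * f b - k a * f a) {a..b}"
  proof (rule fundamental_theorem_of_calculus_interior)
    show "continuous_on {a..b} (\<lambda>x. k x * f x)"
      by (intro continuous_intros contk f)
    fix x assume x: "x \<in> {a<..<b}"
    have "(k has_real_derivative \<alpha> * ((b - x) powr (\<alpha> - 1) + (x - a) powr (\<alpha> - 1))) (at x)"
      unfolding k_def using x
      by (auto intro!: derivative_eq_intros simp: algebra_simps)
    from DERIV_mult[OF this f'[OF x]]
    show "((\<lambda>x. k x * f x) has_vector_derivative
        k x * f' x + \<alpha> * ((b - x) powr (\<alpha> - 1) * f x + (x - a) powr (\<alpha> - 1) * f x)) (at x)"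
      unfolding has_real_derivative_iff_has_vector_derivative[symmetric]
      by (simp add: algebra_simps)
  qed (use ab in simp)
  moreover have "((\<lambda>x. k x * f' x + \<alpha> * ((b - x) powr (\<alpha> - 1) * f x + (x - a) powr (\<alpha> - 1) * f x))
      has_integral I + \<alpha> * (Gamma \<alpha> * RL_left \<alpha> a f b + Gamma \<alpha> * RL_right \<alpha> b f a)) {a..b}"
    by (intro has_integral_add has_integral_mult_right kf' left right)
  ultimately have "k b * f b - k a * f a
      = I + \<alpha> * (Gamma \<alpha> * RL_left \<alpha> a f b + Gamma \<alpha> * RL_right \<alpha> b f a)"
    by (rule has_integral_unique)
  moreover have "Gamma (\<alpha> + 1) = \<alpha> * Gamma \<alpha>"
    using \<alpha> by (intro Gamma_plus1) (auto elim!: nonpos_Ints_cases)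
  ultimately have "(b - a) powr \<alpha> * (f a + f b)
      = I + Gamma (\<alpha> + 1) * (RL_left \<alpha> a f b + RL_right \<alpha> b f a)"
    by (simp add: k_def algebra_simps)
  then show ?thesis
    using ab by (simp add: I_def k_def field_simps)
qed

section \<open>The trapezoid inequality\<close>

theorem theorem7:
  fixes a b \<alpha> s q r :: real and f f' :: "real \<Rightarrow> real"
  assumes "0 \<le> a" and "a < b"
    and "\<alpha> > 0"
    and "0 < s" and "s \<le> 1"
    and "q \<ge> 1"
    and "a < r" and "r \<le> b"
    and "\<And>x. x \<in> {a<..<b} \<Longrightarrow> (f has_real_derivative f' x) (at x)"
    and "(f has_real_derivative f' a) (at_right a)"
    and "(f has_real_derivative f' b) (at_left b)"
    and "set_integrable lebesgue {a..b} f'"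
    and "s_convex_on s {a..b} (\<lambda>x. \<bar>f' x\<bar> powr q)"
  shows "\<bar>(f a + f r) / 2
           - Gamma (\<alpha> + 1) / (2 * (r - a) powr \<alpha>) * (RL_left \<alpha> a f r + RL_right \<alpha> r f a)\<bar>
         \<le> (r - a) / 2
           * (2 / (\<alpha> + 1) * (1 - 1 / 2 powr \<alpha>)) powr (1 - 1 / q)
           * (incomplete_beta (1 / 2) (s + 1) (\<alpha> + 1)
              - incomplete_beta (1 / 2) (\<alpha> + 1) (s + 1)
              + (2 powr (\<alpha> + s) - 1) / ((\<alpha> + s + 1) * 2 powr (\<alpha> + s))) powr (1 / q)
           * (\<bar>f' a\<bar> powr q + \<bar>f' r\<bar> powr q) powr (1 / q)"
proof -
  define L where "L = r - a"
  define A where "A = 2 / (\<alpha> + 1) * (1 - 1 / 2 powr \<alpha>)"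
  define C where "C = incomplete_beta (1 / 2) (s + 1) (\<alpha> + 1)
      - incomplete_beta (1 / 2) (\<alpha> + 1) (s + 1)
      + (2 powr (\<alpha> + s) - 1) / ((\<alpha> + s + 1) * 2 powr (\<alpha> + s))"
  define P where "P = \<bar>f' a\<bar> powr q"
  define R where "R = \<bar>f' r\<bar> powr q"
  define w where "w = (\<lambda>t::real. \<bar>(1 - t) powr \<alpha> - t powr \<alpha>\<bar>)"
  define H where "H = (\<lambda>t. t powr s * P + (1 - t) powr s * R)"
  define T where "T = (\<lambda>x. (r - x) / L)"
  define k where "k = (\<lambda>x. (x - a) powr \<alpha> - (r - x) powr \<alpha>)"
  note \<alpha> = \<open>\<alpha> > 0\<close>
  have L: "0 < L" using \<open>a < r\<close> by (simp add: L_def)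
  have A: "0 < A"
    using \<alpha> powr_less_mono[of 0 \<alpha> 2] unfolding A_def
    by (intro mult_pos_pos divide_pos_pos) auto

  have cont: "continuous_on {a..r} f"
  proof (rule continuous_on_IccI)
    show "(f \<longlongrightarrow> f a) (at_right a)"
      using DERIV_continuous[OF assms(10)] by (simp add: continuous_within)
    show "(f \<longlongrightarrow> f r) (at_left r)"
    proof (cases "r = b")
      case True
      then show ?thesis
        using DERIV_continuous[OF assms(11)] by (simp add: continuous_within)
    next
      case False
      then have "isCont f r"
        using assms(7,8) by (intro DERIV_isCont[OF assms(9)]) auto
      then show ?thesis
        by (simp add: isCont_def filterlim_at_split)
    qed
    show "f \<midarrow>x\<rightarrow> f x" if "a < x" "x < r" for x
    proof -
      have "isCont f x"
        using that assms(8) by (intro DERIV_isCont[OF assms(9)]) auto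
      then show ?thesis by (simp add: isCont_def)
    qed
  qed fact
  have int: "f' absolutely_integrable_on {a..r}"
    by (rule set_integrable_subset[OF assms(12)]) (use assms(8) in auto)

  have T: "T x \<in> {0..1}" "T x * a + (1 - T x) * r = x" if "x \<in> {a..r}" for x
  proof -
    show "T x \<in> {0..1}" using that L by (auto simp: T_def L_def field_simps)
    have "T x * L = r - x" using L by (simp add: T_def)
    then show "T x * a + (1 - T x) * r = x" by (simp add: L_def algebra_simps)
  qed
  have k_eq: "\<bar>k x\<bar> = L powr \<alpha> * w (T x)" if "x \<in> {a..r}" for x
  proof -
    have scale: "x - a = L * (1 - T x)" "r - x = L * T x"
      using L by (simp_all add: T_def L_def field_simps)
    have "k x = L powr \<alpha> * ((1 - T x) powr \<alpha> - T x powr \<alpha>)"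
      unfolding k_def by (simp only: scale powr_mult) (simp only: right_diff_distrib)
    then show ?thesis by (simp add: w_def abs_mult)
  qed
  have contk: "continuous_on {a..r} k"
    unfolding k_def using \<alpha> by (intro continuous_intros continuous_on_powr') auto

  have transfer: "((\<lambda>x. g (T x)) has_integral L * I) {a..r}"
    if "(g has_integral I) {0..1}" for g I
    using has_integral_reflect_scale[OF that L, of r] by (simp add: T_def L_def)
  have wA: "((\<lambda>x. w (T x)) has_integral L * A) {a..r}"
    using has_integral_abs_powr_diff[OF \<alpha>] unfolding w_def A_def by (rule transfer)
  have wt: "((\<lambda>t. w t * t powr s) has_integral C) {0..1}"
    using has_integral_abs_powr_diff_times_powr[OF \<alpha> \<open>0 < s\<close>] unfolding w_def C_def .
  have wt': "((\<lambda>t. w t * (1 - t) powr s) has_integral C) {0..1}"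
    using has_integral_reflect_scale[OF wt, of 1 1] by (simp add: w_def abs_minus_commute)
  have "((\<lambda>t. w t * t powr s * P + w t * (1 - t) powr s * R) has_integral C * P + C * R) {0..1}"
    by (intro has_integral_add has_integral_mult_left wt wt')
  then have "((\<lambda>t. w t * H t) has_integral C * (P + R)) {0..1}"
    by (simp add: H_def algebra_simps)
  then have wH: "((\<lambda>x. w (T x) * H (T x)) has_integral L * (C * (P + R))) {a..r}"
    by (rule transfer)
  have f'H: "\<bar>f' x\<bar> powr q \<le> H (T x)" if "x \<in> {a..r}" for x
  proof -
    have "a \<in> {a..b}" "r \<in> {a..b}" using \<open>a < r\<close> \<open>r \<le> b\<close> by auto
    then have "\<bar>f' (T x * a + (1 - T x) * r)\<bar> powr q
        \<le> T x powr s * \<bar>f' a\<bar> powr q + (1 - T x) powr s * \<bar>f' r\<bar> powr q"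
      using assms(13) T(1)[OF that] unfolding s_convex_on_def by blast
    then show ?thesis
      unfolding H_def P_def R_def T(2)[OF that] .
  qed

  have "(\<lambda>x. \<bar>k x\<bar> * \<bar>f' x\<bar>) absolutely_integrable_on {a..r}"
    by (intro continuous_times_absolutely_integrable continuous_on_rabs contk set_integrable_abs int)
  then have kint: "(\<lambda>x. \<bar>k x\<bar> * \<bar>f' x\<bar>) integrable_on {a..r}"
    by (rule set_lebesgue_integral_eq_integral(1))
  \<comment> \<open>The integral of \<open>w (T x) * \<bar>f' x\<bar>\<close>, which exists because \<open>w \<circ> T\<close> is a multiple of \<open>\<bar>k\<bar>\<close>.\<close>
  define J where "J = integral {a..r} (\<lambda>x. \<bar>k x\<bar> * \<bar>f' x\<bar>) / L powr \<alpha>"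
  have "((\<lambda>x. \<bar>k x\<bar> * \<bar>f' x\<bar> / L powr \<alpha>) has_integral J) {a..r}"
    unfolding J_def by (intro has_integral_divide integrable_integral kint)
  then have wf': "((\<lambda>x. w (T x) * \<bar>f' x\<bar>) has_integral J) {a..r}"
    by (rule has_integral_eq[rotated]) (use L k_eq in auto)
  have "J \<le> (L * A) powr (1 - 1 / q) * (L * (C * (P + R))) powr (1 / q)"
    by (rule weighted_power_mean[OF \<open>q \<ge> 1\<close> wA _ _ wf' _ wH])
       (use L A f'H in \<open>auto simp: w_def\<close>)
  also have "\<dots> = L powr (1 - 1 / q) * L powr (1 / q)
      * (A powr (1 - 1 / q) * C powr (1 / q) * (P + R) powr (1 / q))"
    by (simp add: powr_mult)
  also have "L powr (1 - 1 / q) * L powr (1 / q) = L"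
    using L by (simp add: powr_add[symmetric])
  finally have J: "J \<le> L * (A powr (1 - 1 / q) * C powr (1 / q) * (P + R) powr (1 / q))" .

  have "\<bar>integral {a..r} (\<lambda>x. k x * f' x)\<bar> \<le> integral {a..r} (\<lambda>x. \<bar>k x\<bar> * \<bar>f' x\<bar>)"
  proof -
    have "(\<lambda>x. k x * f' x) integrable_on {a..r}"
      by (intro set_lebesgue_integral_eq_integral(1)
            continuous_times_absolutely_integrable contk int)
    then have "norm (integral {a..r} (\<lambda>x. k x * f' x)) \<le> integral {a..r} (\<lambda>x. \<bar>k x\<bar> * \<bar>f' x\<bar>)"
      using kint by (rule Henstock_Kurzweil_Integration.integral_norm_bound_integral) (simp add: abs_mult)
    then show ?thesis by simp
  qed
  also have "\<dots> = L powr \<alpha> * J"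
    using L by (simp add: J_def)
  finally have "\<bar>integral {a..r} (\<lambda>x. k x * f' x)\<bar> / (2 * L powr \<alpha>) \<le> J / 2"
    using L by (simp add: field_simps)
  moreover have "(f a + f r) / 2
           - Gamma (\<alpha> + 1) / (2 * (r - a) powr \<alpha>) * (RL_left \<alpha> a f r + RL_right \<alpha> r f a)
      = integral {a..r} (\<lambda>x. k x * f' x) / (2 * L powr \<alpha>)"
    unfolding k_def L_def using assms(8,9)
    by (intro fractional_trapezoid_identity[OF \<open>a < r\<close> \<alpha> cont _ int]) auto
  ultimately have "\<bar>(f a + f r) / 2
           - Gamma (\<alpha> + 1) / (2 * (r - a) powr \<alpha>) * (RL_left \<alpha> a f r + RL_right \<alpha> r f a)\<bar> \<le> J / 2"
    by simp
  also have "\<dots> \<le> L / 2 * A powr (1 - 1 / q) * C powr (1 / q) * (P + R) powr (1 / q)"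
    using J by simp
  finally show ?thesis
    unfolding L_def A_def C_def P_def R_def .
qed

end
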